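(* Let $\mathcal X$ be a finite-dimensional Euclidean space, let $\kappa:\mathcal X\to\mathbb R\cup\{+\infty\}$ be a gauge, and let $\mathcal C\subseteq\mathcal X$ be a nonempty closed convex set with $0\notin\mathcal C$. Define $$v_p=\inf_x\{\kappa(x)\mid x\in\mathcal C\},\qquad v_g=\inf_y\{\kappa^\circ(y)\mid y\in\mathcal C'\},\qquad v_f=\sup_y\{-\sigma_{\mathcal C}(-y)\mid \kappa^\circ(y)\le 1\}.$$ Suppose that $\operatorname{dom}\kappa^\circ\cap\mathcal C'\neq\emptyset$. Then $$v_p\ge v_f=1/v_g>0.$$ Furthermore: (i) if $y^*$ solves the problem of maximizing $-\sigma_{\mathcal C}(-y)$ subject to $\kappa^\circ(y)\le 1$, then $y^*\in\operatorname{cone}\mathcal C'$ and $y^*/v_f$ solves the problem of minimizing $\kappa^\circ(y)$ subject to $y\in\mathcal C'$; (ii) if $y^*$ solves the problem of minimizing $\kappa^\circ(y)$ subject to $y\in\mathcal C'$ and $v_g>0$, then $v_f\,y^*$ solves the problem of maximizing $-\sigma_{\mathcal C}(-y)$ subject to $\kappa^\circ(y)\le 1$.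
   Context: A gauge is a nonnegative, positively homogeneous convex function $\kappa:\mathcal X\to\mathbb R\cup\{+\infty\}$ with $\kappa(0)=0$; $\operatorname{dom}\kappa=\{x\mid\kappa(x)<\infty\}$. Its polar is the gauge $\kappa^\circ(y)=\inf\{\mu>0\mid\langle x,y\rangle\le\mu\kappa(x)\ \forall x\}$ (with $\inf\emptyset=+\infty$). The antipolar of a set $\mathcal C$ is $\mathcal C'=\{y\mid\langle y,x\rangle\ge1\ \forall x\in\mathcal C\}$. The support function is $\sigma_{\mathcal C}(y)=\sup_{x\in\mathcal C}\langle x,y\rangle$. The conic hull is $\operatorname{cone}\mathcal D=\bigcup_{\lambda\ge0}\lambda\mathcal D$. A point solves a problem if it is feasible and attains the optimal value. Convention: $1/v_g=+\infty$ when $v_g=0$. *)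

theory Defs
  imports "HOL-Analysis.Analysis"
begin

text \<open>Nonnegativity excludes the value \<open>-\<infinity>\<close>, so \<^typ>\<open>ereal\<close> here stands for
  \<open>\<real> \<union> {+\<infinity>}\<close>, and no sum of opposite infinities occurs in the convexity inequality.\<close>

definition is_gauge :: "('a::real_vector \<Rightarrow> ereal) \<Rightarrow> bool" where
  "is_gauge \<kappa> \<longleftrightarrow>
     (\<forall>x. 0 \<le> \<kappa> x) \<and>
     (\<forall>c>0. \<forall>x. \<kappa> (c *\<^sub>R x) = ereal c * \<kappa> x) \<and>
     (\<forall>x y. \<forall>t. 0 < t \<and> t < 1 \<longrightarrow>
        \<kappa> ((1 - t) *\<^sub>R x + t *\<^sub>R y) \<le> ereal (1 - t) * \<kappa> x + ereal t * \<kappa> y) \<and>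
     \<kappa> 0 = 0"

definition effective_domain :: "('a \<Rightarrow> ereal) \<Rightarrow> 'a set" where
  "effective_domain f = {x. f x < \<infinity>}"

text \<open>The infimum of the empty set in \<^typ>\<open>ereal\<close> is \<open>\<infinity>\<close>.\<close>

definition gauge_polar :: "('a::real_inner \<Rightarrow> ereal) \<Rightarrow> 'a \<Rightarrow> ereal" where
  "gauge_polar \<kappa> y =
     Inf {ereal \<mu> | \<mu>. 0 < \<mu> \<and> (\<forall>x. ereal (x \<bullet> y) \<le> ereal \<mu> * \<kappa> x)}"

definition antipolar :: "'a::real_inner set \<Rightarrow> 'a set" where
  "antipolar C = {y. \<forall>x\<in>C. y \<bullet> x \<ge> 1}"

definition support_function :: "'a::real_inner set \<Rightarrow> 'a \<Rightarrow> ereal" where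
  "support_function C y = (SUP x\<in>C. ereal (x \<bullet> y))"

definition solves_min :: "('a \<Rightarrow> ereal) \<Rightarrow> 'a set \<Rightarrow> 'a \<Rightarrow> bool" where
  "solves_min f S y \<longleftrightarrow> y \<in> S \<and> f y = (INF z\<in>S. f z)"

definition solves_max :: "('a \<Rightarrow> ereal) \<Rightarrow> 'a set \<Rightarrow> 'a \<Rightarrow> bool" where
  "solves_max f S y \<longleftrightarrow> y \<in> S \<and> f y = (SUP z\<in>S. f z)"

text \<open>The library's \<open>conic hull\<close> is an intersection of cones; it is the union of the
  nonnegative multiples of the set.\<close>

lemma conic_hull_eq_UN:
  fixes D :: "'a::real_vector set"
  shows "conic hull D = (\<Union>c\<in>{0..}. (\<lambda>x. c *\<^sub>R x) ` D)"
  by (auto simp: conic_hull_explicit)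

end

theory Submission
  imports Defs
begin

text \<open>The constraint \<open>\<langle>x, y\<rangle> \<ge> c\<close> for all \<open>x \<in> C\<close>, with \<open>c > 0\<close>, says exactly that \<open>y / c\<close> lies in
  the antipolar of \<open>C\<close>. Since the polar gauge is positively homogeneous, scaling by \<open>c\<close> exchanges
  the points \<open>y\<close> of the antipolar with \<open>\<kappa>\<^sup>\<circ>(y) \<le> 1 / c\<close> and the points of the polar unit ball with
  dual objective at least \<open>c\<close>; this gives \<open>v_f = 1 / v_g\<close> and the correspondence of solutions. Weak
  duality is the polar gauge inequality \<open>\<langle>x, y\<rangle> \<le> \<kappa>(x)\<close> on the polar unit ball.\<close>

text \<open>Division on \<open>ereal\<close> has \<open>inverse 0 = \<infinity>\<close>, which is
  the convention for \<open>1 / v_g\<close> at \<open>v_g = 0\<close>.\<close>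

lemma one_divide_ereal: "1 / ereal r = (if r = 0 then \<infinity> else ereal (1 / r))"
  by (simp add: divide_ereal_def inverse_eq_divide)

lemma gauge_polar_nonneg: "0 \<le> gauge_polar \<kappa> y"
  unfolding gauge_polar_def by (auto intro!: Inf_greatest)

text \<open>If \<open>\<mu>\<close> is admissible in the infimum for \<open>y\<close>, then
  \<open>c * \<mu>\<close> is admissible for \<open>c *\<^sub>R y\<close>.\<close>

lemma gauge_polar_scaleR_le:
  assumes "c > 0"
  shows "gauge_polar \<kappa> (c *\<^sub>R y) \<le> ereal c * gauge_polar \<kappa> y"
proof -
  have "gauge_polar \<kappa> (c *\<^sub>R y) / ereal c \<le> gauge_polar \<kappa> y"
    unfolding gauge_polar_def[of \<kappa> y]
  proof (rule Inf_greatest, clarify)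
    fix \<mu> :: real
    assume \<mu>: "0 < \<mu>" "\<forall>x. ereal (x \<bullet> y) \<le> ereal \<mu> * \<kappa> x"
    have "ereal (x \<bullet> c *\<^sub>R y) \<le> ereal (c * \<mu>) * \<kappa> x" for x
    proof -
      have "ereal c * ereal (x \<bullet> y) \<le> ereal c * (ereal \<mu> * \<kappa> x)"
        using \<mu>(2) assms by (intro ereal_mult_left_mono) auto
      then show ?thesis
        by (simp add: mult.assoc flip: times_ereal.simps(1))
    qed
    then have "gauge_polar \<kappa> (c *\<^sub>R y) \<le> ereal (c * \<mu>)"
      unfolding gauge_polar_def using assms \<mu>(1) by (intro Inf_lower) auto
    then show "gauge_polar \<kappa> (c *\<^sub>R y) / ereal c \<le> ereal \<mu>"
      using assms by (simp add: ereal_divide_le_pos)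
  qed
  then show ?thesis
    using assms by (simp add: ereal_divide_le_pos)
qed

text \<open>The infimum defining the polar need not be attained, so \<open>\<mu> = 1\<close> is not
  directly available. Each \<open>t > 1\<close> lies above some admissible \<open>\<mu>\<close>, and
  \<open>t\<close> then tends to 1.\<close>

lemma inner_le_gauge:
  assumes nonneg: "0 \<le> \<kappa> x" and polar: "gauge_polar \<kappa> y \<le> 1"
  shows "ereal (x \<bullet> y) \<le> \<kappa> x"
proof (cases "\<kappa> x")
  case (real r)
  have "x \<bullet> y \<le> t * r" if "t > 1" for t
  proof -
    have "gauge_polar \<kappa> y < ereal t"
      using polar by (rule le_less_trans) (use that in \<open>simp add: one_ereal_def\<close>)
    then obtain \<mu> where \<mu>: "\<mu> < t" "ereal (x \<bullet> y) \<le> ereal \<mu> * \<kappa> x"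
      unfolding gauge_polar_def Inf_less_iff by auto
    have "x \<bullet> y \<le> \<mu> * r"
      using \<mu>(2) real by simp
    also have "\<dots> \<le> t * r"
      using \<mu>(1) nonneg real by (intro mult_right_mono) auto
    finally show ?thesis .
  qed
  then have "\<forall>\<^sub>F t in at_right 1. x \<bullet> y \<le> t * r"
    by (auto simp: eventually_at_filter)
  moreover have "((\<lambda>t. t * r) \<longlongrightarrow> 1 * r) (at_right 1)"
    by (intro tendsto_intros)
  ultimately have "x \<bullet> y \<le> 1 * r"
    by (intro tendsto_lowerbound) auto
  then show ?thesis
    using real by simp
qed (use nonneg in auto)

text \<open>The dual objective is the infimum of \<open>x \<bullet> y\<close> over
  \<open>x \<in> C\<close>, so its lower bounds can be tested pointwise.\<close>

lemma le_neg_support_function_iff: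
  "ereal b \<le> - support_function C (- y) \<longleftrightarrow> (\<forall>x\<in>C. b \<le> x \<bullet> y)"
proof -
  have "ereal b \<le> - support_function C (- y) \<longleftrightarrow> support_function C (- y) \<le> ereal (- b)"
    using ereal_minus_le_minus[of "- support_function C (- y)" "ereal b"]
    by (simp only: ereal_uminus_uminus uminus_ereal.simps)
  also have "\<dots> \<longleftrightarrow> (\<forall>x\<in>C. b \<le> x \<bullet> y)"
    by (auto simp: support_function_def SUP_le_iff)
  finally show ?thesis .
qed

lemma neg_support_function_le: "x \<in> C \<Longrightarrow> - support_function C (- y) \<le> ereal (x \<bullet> y)"
  unfolding support_function_def
  by (auto simp: ereal_uminus_le_reorder intro!: SUP_upper2)

lemma antipolar_iff_neg_support_function:
  assumes "c > 0"
  shows "y \<in> antipolar C \<longleftrightarrow> ereal c \<le> - support_function C (- (c *\<^sub>R y))"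
  using assms by (simp add: le_neg_support_function_iff antipolar_def inner_commute)

theorem theorem5p1:
  fixes \<kappa> :: "'a::euclidean_space \<Rightarrow> ereal"
    and C :: "'a set"
    and v_p v_g v_f :: ereal
  assumes "is_gauge \<kappa>"
    and "C \<noteq> {}" and "closed C" and "convex C" and "0 \<notin> C"
    and "v_p = (INF x\<in>C. \<kappa> x)"
    and "v_g = (INF y\<in>antipolar C. gauge_polar \<kappa> y)"
    and "v_f = (SUP y\<in>{y. gauge_polar \<kappa> y \<le> 1}. - support_function C (- y))"
    and "effective_domain (gauge_polar \<kappa>) \<inter> antipolar C \<noteq> {}"
  shows "v_p \<ge> v_f \<and> v_f = 1 / v_g \<and> 1 / v_g > 0
    \<and> (\<forall>y. solves_max (\<lambda>y. - support_function C (- y)) {y. gauge_polar \<kappa> y \<le> 1} y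
          \<longrightarrow> y \<in> conic hull (antipolar C)
            \<and> solves_min (gauge_polar \<kappa>) (antipolar C) (y /\<^sub>R real_of_ereal v_f))
    \<and> (\<forall>y. solves_min (gauge_polar \<kappa>) (antipolar C) y \<and> v_g > 0
          \<longrightarrow> solves_max (\<lambda>y. - support_function C (- y)) {y. gauge_polar \<kappa> y \<le> 1}
                (real_of_ereal v_f *\<^sub>R y))"
proof -
  let ?\<phi> = "\<lambda>y. - support_function C (- y)"
  have vg0: "0 \<le> v_g"
    unfolding assms(7) by (intro INF_greatest gauge_polar_nonneg)
  \<comment> \<open>Since \<open>1 / \<infinity> = 0\<close>, positivity of \<open>1 / v_g\<close>
    rests on the antipolar point where the polar is finite.\<close>
  have vg_fin: "v_g < \<infinity>"
    using assms(9) unfolding assms(7) effective_domain_def INF_less_iff by blast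
  have pos: "1 / v_g > 0"
    using vg0 vg_fin by (cases v_g) (auto simp: one_divide_ereal)
  \<comment> \<open>The two directions of the scaling. The level \<open>c\<close> stays free: both
    the comparison of optimal values and the transfer of solutions instantiate it.\<close>
  have to_ball: "gauge_polar \<kappa> (c *\<^sub>R y) \<le> 1 \<and> ereal c \<le> ?\<phi> (c *\<^sub>R y)"
    if "y \<in> antipolar C" "c > 0" "gauge_polar \<kappa> y \<le> ereal (1 / c)" for y c
  proof -
    have "gauge_polar \<kappa> (c *\<^sub>R y) \<le> ereal c * ereal (1 / c)"
      using gauge_polar_scaleR_le[OF that(2)] ereal_mult_left_mono[OF that(3), of "ereal c"] that(2)
      by (auto intro: order_trans)
    then show ?thesis
      using that antipolar_iff_neg_support_function by (auto simp: one_ereal_def)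
  qed
  have to_antipolar: "y /\<^sub>R c \<in> antipolar C \<and> gauge_polar \<kappa> (y /\<^sub>R c) \<le> ereal (1 / c)"
    if "gauge_polar \<kappa> y \<le> 1" "c > 0" "ereal c \<le> ?\<phi> y" for y c
  proof -
    have "gauge_polar \<kappa> (y /\<^sub>R c) \<le> ereal (inverse c) * 1"
      using gauge_polar_scaleR_le[of "inverse c" \<kappa> y] that(2)
        ereal_mult_left_mono[OF that(1), of "ereal (inverse c)"]
      by (auto intro: order_trans)
    then show ?thesis
      using that antipolar_iff_neg_support_function[OF that(2), of "y /\<^sub>R c" C]
      by (auto simp: inverse_eq_divide)
  qed
  have weak: "v_f \<le> v_p"
    unfolding assms(6,8)
  proof (intro SUP_least INF_greatest)
    fix x y assume "y \<in> {y. gauge_polar \<kappa> y \<le> 1}" "x \<in> C"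
    then show "?\<phi> y \<le> \<kappa> x"
      using neg_support_function_le[of x C y] inner_le_gauge[of \<kappa> x y] assms(1)
      unfolding is_gauge_def by (auto intro: order_trans)
  qed
  have vf_le: "v_f \<le> 1 / v_g"
    unfolding assms(8)
  proof (rule SUP_least)
    fix y assume y: "y \<in> {y. gauge_polar \<kappa> y \<le> 1}"
    obtain x where "x \<in> C"
      using assms(2) by auto
    then have fin: "?\<phi> y < \<infinity>"
      using neg_support_function_le[of x C y] by (rule_tac le_less_trans) auto
    show "?\<phi> y \<le> 1 / v_g"
    \<comment> \<open>Only a positive objective value can be scaled to 1, which puts the point in
      the antipolar; other values lie below \<open>1 / v_g\<close> anyway.\<close>
    proof (cases "?\<phi> y \<le> 0")
      case True
      then show ?thesis using pos by (rule order_trans[OF _ less_imp_le])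
    next
      case False
      with fin obtain b where b: "?\<phi> y = ereal b" "b > 0"
        by (cases "?\<phi> y") auto
      then have "v_g \<le> ereal (1 / b)"
        unfolding assms(7) using to_antipolar[of y b] y by (intro INF_lower2) auto
      then show ?thesis
        using vg0 b by (cases v_g) (auto simp: one_divide_ereal field_simps)
    qed
  qed
  have vf_ge: "1 / v_g \<le> v_f"
  \<comment> \<open>\<open>v_g\<close> may be unattained and \<open>1 / v_g\<close> infinite. A real
    \<open>c\<close> strictly between 0 and \<open>1 / v_g\<close> leaves room for an antipolar
    point with polar value below \<open>1 / c\<close>.\<close>
  proof (rule dense_le_bounded[OF pos])
    fix w assume w: "0 < w" "w < 1 / v_g"
    then obtain c where c: "w = ereal c" "c > 0"
      by (cases w) auto
    have "v_g < ereal (1 / c)"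
      using w c vg0 vg_fin by (cases v_g) (auto simp: one_divide_ereal field_simps split: if_splits)
    then obtain y where "y \<in> antipolar C" "gauge_polar \<kappa> y < ereal (1 / c)"
      unfolding assms(7) by (auto simp: INF_less_iff)
    then show "w \<le> v_f"
      unfolding assms(8) c(1) using to_ball[of y c] c(2) by (intro SUP_upper2[of "c *\<^sub>R y"]) auto
  qed
  have vf_eq: "v_f = 1 / v_g"
    using vf_le vf_ge by simp
  have max_to_min: "y \<in> conic hull (antipolar C)
      \<and> solves_min (gauge_polar \<kappa>) (antipolar C) (y /\<^sub>R real_of_ereal v_f)"
    if "solves_max ?\<phi> {y. gauge_polar \<kappa> y \<le> 1} y" for y
  proof -
    have y: "gauge_polar \<kappa> y \<le> 1" "?\<phi> y = v_f"
      using that unfolding solves_max_def assms(8) by auto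
    \<comment> \<open>\<open>real_of_ereal\<close> sends \<infinity> to 0, so \<open>v_f\<close> has
      to be finite. Being attained at \<open>y\<close>, it is bounded by
      \<open>x \<bullet> y\<close> for any \<open>x \<in> C\<close>.\<close>
    obtain x where "x \<in> C"
      using assms(2) by auto
    then have "v_f \<le> ereal (x \<bullet> y)"
      using neg_support_function_le[of x C y] y(2) by simp
    then obtain b where b: "v_f = ereal b" "b > 0"
      using pos[folded vf_eq] by (cases v_f) auto
    have ap: "y /\<^sub>R b \<in> antipolar C" "gauge_polar \<kappa> (y /\<^sub>R b) \<le> ereal (1 / b)"
      using to_antipolar[of y b] y b by auto
    have "v_g = ereal (1 / b)"
      using vf_eq b vg0 by (cases v_g) (auto simp: one_divide_ereal field_simps split: if_splits)
    moreover have "v_g \<le> gauge_polar \<kappa> (y /\<^sub>R b)"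
      unfolding assms(7) using ap(1) by (rule INF_lower)
    ultimately have "gauge_polar \<kappa> (y /\<^sub>R b) = v_g"
      using ap(2) by simp
    moreover have "y = b *\<^sub>R (y /\<^sub>R b)"
      using b(2) by simp
    ultimately show ?thesis
      using ap(1) b unfolding solves_min_def conic_hull_explicit assms(7)
      by (auto intro!: exI[of _ b] exI[of _ "y /\<^sub>R b"])
  qed
  have min_to_max: "solves_max ?\<phi> {y. gauge_polar \<kappa> y \<le> 1} (real_of_ereal v_f *\<^sub>R y)"
    if min: "solves_min (gauge_polar \<kappa>) (antipolar C) y" and vg_pos: "v_g > 0" for y
  proof -
    \<comment> \<open>Here \<open>v_g > 0\<close> is what makes \<open>v_f = 1 / v_g\<close> finite,
      so that \<open>real_of_ereal v_f\<close> is the true factor \<open>1 / r\<close>.\<close>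
    obtain r where r: "v_g = ereal r" "r > 0"
      using vg_pos vg_fin by (cases v_g) auto
    have vf: "v_f = ereal (1 / r)"
      using vf_eq r by (simp add: one_divide_ereal)
    have "y \<in> antipolar C" "gauge_polar \<kappa> y = ereal r"
      using min r(1) unfolding solves_min_def assms(7) by auto
    then have ball: "gauge_polar \<kappa> ((1 / r) *\<^sub>R y) \<le> 1" "v_f \<le> ?\<phi> ((1 / r) *\<^sub>R y)"
      using to_ball[of y "1 / r"] r(2) vf by auto
    moreover have "?\<phi> ((1 / r) *\<^sub>R y) \<le> v_f"
      unfolding assms(8) using ball(1) by (intro SUP_upper) auto
    ultimately have "?\<phi> ((1 / r) *\<^sub>R y) = v_f"
      by simp
    moreover have "real_of_ereal v_f = 1 / r"
      using vf by simp
    ultimately show ?thesis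
      unfolding solves_max_def using ball(1) assms(8) by simp
  qed
  show ?thesis
    using weak vf_eq pos max_to_min min_to_max by blast
qed

end
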